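(* Let $\boldsymbol X,\boldsymbol X_i$, $i\ge1$, be iid random vectors in $\mathbb R^2$ whose common distribution satisfies $$nP\left[\frac{\boldsymbol X-d_n\boldsymbol 1}{c_n}\in\cdot\,\right]\stackrel{v}{\rightarrow}\nu^0(\cdot)\quad\text{in }M_+(E^0)\qquad(n\to\infty)$$ for some constants $c_n>0$, $d_n\in\mathbb R$ and a nonzero $\nu^0\in M_+(E^0)$. Let $\hat c(n/k)$ and $\hat d(n/k)$ be estimators of $c(n/k)$ and $d(n/k)$ satisfying $$\frac{c(n/k)}{\hat c(n/k)}\stackrel{P}{\rightarrow}1,\qquad \frac{d(n/k)-\hat d(n/k)}{c(n/k)}\stackrel{P}{\rightarrow}0\qquad (k\to\infty,\ n/k\to\infty).$$ Then in $M_+(E^0)$, $$\widehat{\nu^0_n}(\cdot):=\frac1k\sum_{i=1}^n\epsilon_{\left(\frac{\boldsymbol X_i-\hat d(n/k)\boldsymbol 1}{\hat c(n/k)}\right)}(\cdot)\Rightarrow\nu^0(\cdot)\qquad(k\to\infty,\ n/k\to\infty).$$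
   Context: Notation. $\boldsymbol 1=(1,1)$; superscripts denote components, and $x^{(2)}=x^1\wedge x^2$. $M_+(F)$ is the set of nonnegative Radon measures on $F$ with the vague topology; $\stackrel{v}{\rightarrow}$ is vague convergence and $\Rightarrow$ is weak convergence (here of random elements of $M_+(E^0)$). $\epsilon_x$ is the unit point mass at $x$; point measures are restricted to $E^0$. The cone $E^0$ is either $(-\infty,\infty]^2$ or $(0,\infty]^2$. Here $k=k(n)$ is a sequence with $k\to\infty$ and $n/k\to\infty$ as $n\to\infty$, and $c(t)=c_{\lfloor t\rfloor}$, $d(t)=d_{\lfloor t\rfloor}$. The estimators $\hat c(n/k),\hat d(n/k)$ are computed from the iid sample of minima $X^{(2)}_i=X^1_i\wedge X^2_i$, $i=1,\dots,n$. *)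

theory Defs
  imports "HOL-Probability.Probability"
begin

section \<open>Radon measures and the vague topology\<close>

text \<open>
  A measure on a subset E of a topological space lives on the trace of the Borel sigma-algebra on
  E. Radon means finite on compact sets; this is the usual convention on locally compact second
  countable spaces, such as the cones below. Compactness in the subspace E is the same as
  compactness in the ambient space together with inclusion in E.
\<close>

definition radon_measures :: "'a::topological_space set \<Rightarrow> 'a measure set" where
  "radon_measures E = {\<mu>. sets \<mu> = sets (restrict_space borel E) \<and>
     (\<forall>K. compact K \<and> K \<subseteq> E \<longrightarrow> emeasure \<mu> K < \<infinity>)}"

definition Ck_plus :: "'a::topological_space set \<Rightarrow> ('a \<Rightarrow> real) set" where
  "Ck_plus E = {f. continuous_on E f \<and> (\<forall>x\<in>E. 0 \<le> f x) \<and>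
     (\<exists>K. compact K \<and> K \<subseteq> E \<and> (\<forall>x\<in>E - K. f x = 0))}"

definition vague_topology :: "'a::topological_space set \<Rightarrow> 'a measure topology" where
  "vague_topology E = topology_generated_by
     {{\<mu> \<in> radon_measures E. (\<integral>x. f x \<partial>\<mu>) \<in> U} | f U. f \<in> Ck_plus E \<and> open U}"

lemma topspace_vague_topology [simp]: "topspace (vague_topology E) = radon_measures E"
proof -
  have "\<exists>f U. radon_measures E = {\<mu> \<in> radon_measures E. (\<integral>x. f x \<partial>\<mu>) \<in> U} \<and> f \<in> Ck_plus E \<and> open U"
    by (rule exI[of _ "\<lambda>_. 0"], rule exI[of _ UNIV]) (auto simp: Ck_plus_def intro: exI[of _ "{}"])
  then show ?thesis
    unfolding vague_topology_def topology_generated_by_topspace by blast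
qed

section \<open>Weak convergence of random elements and convergence in probability\<close>

definition borel_sets_of :: "'b topology \<Rightarrow> 'b measure" where
  "borel_sets_of T = sigma (topspace T) {U. openin T U}"

definition converges_weakly ::
  "'w measure \<Rightarrow> 'b topology \<Rightarrow> (nat \<Rightarrow> 'w \<Rightarrow> 'b) \<Rightarrow> ('w \<Rightarrow> 'b) \<Rightarrow> bool" where
  "converges_weakly M T Y Z \<longleftrightarrow>
     (\<forall>n. Y n \<in> measurable M (borel_sets_of T)) \<and> Z \<in> measurable M (borel_sets_of T) \<and>
     (\<forall>F. continuous_map T euclideanreal F \<and> bounded (F ` topspace T) \<longrightarrow>
        (\<lambda>n. \<integral>\<omega>. F (Y n \<omega>) \<partial>M) \<longlonglongrightarrow> (\<integral>\<omega>. F (Z \<omega>) \<partial>M))"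

definition converges_in_prob :: "'w measure \<Rightarrow> (nat \<Rightarrow> 'w \<Rightarrow> real) \<Rightarrow> real \<Rightarrow> bool" where
  "converges_in_prob M Y l \<longleftrightarrow>
     (\<forall>\<epsilon>>0. (\<lambda>n. measure M {\<omega> \<in> space M. \<bar>Y n \<omega> - l\<bar> > \<epsilon>}) \<longlonglongrightarrow> 0)"

section \<open>Normalized vectors and empirical measures\<close>

text \<open>The vector (x - b 1) / a, viewed in the compactified plane.\<close>

definition normalize_vec :: "real \<Rightarrow> real \<Rightarrow> real \<times> real \<Rightarrow> ereal \<times> ereal" where
  "normalize_vec a b x = (ereal ((fst x - b) / a), ereal ((snd x - b) / a))"

text \<open>
  The measure (1/k) times the sum over i = 1..n of the unit masses at x i. The measurable sets A
  are subsets of E, so points outside E do not contribute.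
\<close>

definition empirical_measure ::
  "'a::topological_space set \<Rightarrow> nat \<Rightarrow> nat \<Rightarrow> (nat \<Rightarrow> 'a) \<Rightarrow> 'a measure" where
  "empirical_measure E k n x =
     measure_of E (sets (restrict_space borel E))
       (\<lambda>A. ennreal (1 / real k) * (\<Sum>i=1..n. indicator A (x i)))"

lemma space_empirical_measure [simp]: "space (empirical_measure E k n x) = E"
  using sets.space_closed[of "restrict_space borel E"]
  by (simp add: empirical_measure_def space_measure_of space_restrict_space)

lemma sets_empirical_measure [simp]:
  "sets (empirical_measure E k n x) = sets (restrict_space borel E)"
  using sets.sigma_sets_eq[of "restrict_space borel E"]
    sets.space_closed[of "restrict_space borel E"]
  by (simp add: empirical_measure_def space_restrict_space)

lemma emeasure_empirical_measure:
  assumes "A \<in> sets (restrict_space borel E)"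
  shows "emeasure (empirical_measure E k n x) A =
    ennreal (1 / real k) * (\<Sum>i=1..n. indicator A (x i))"
proof (rule emeasure_measure_of[OF empirical_measure_def])
  show "sets (restrict_space borel E) \<subseteq> Pow E"
    using sets.space_closed[of "restrict_space borel E"] by (simp add: space_restrict_space)
  show "A \<in> sets (empirical_measure E k n x)" using assms by simp
  show "positive (sets (empirical_measure E k n x))
     (\<lambda>A. ennreal (1 / real k) * (\<Sum>i=1..n. indicator A (x i)))"
    by (simp add: positive_def)
  show "countably_additive (sets (empirical_measure E k n x))
     (\<lambda>A. ennreal (1 / real k) * (\<Sum>i=1..n. indicator A (x i)))"
  proof (rule countably_additiveI)
    fix B :: "nat \<Rightarrow> 'a set"
    assume "disjoint_family B"
    then have "(\<Sum>j. indicator (B j) y) = (indicator (\<Union>j. B j) y :: ennreal)" for y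
      by (rule suminf_indicator)
    then show "(\<Sum>j. ennreal (1 / real k) * (\<Sum>i=1..n. indicator (B j) (x i))) =
      ennreal (1 / real k) * (\<Sum>i=1..n. indicator (\<Union>j. B j) (x i))"
      by (simp add: suminf_sum)
  qed
qed

text \<open>The sample of componentwise minima with indices 1..n, as a function on {1..n}.\<close>

definition minima_sample :: "(nat \<Rightarrow> 'w \<Rightarrow> real \<times> real) \<Rightarrow> nat \<Rightarrow> 'w \<Rightarrow> nat \<Rightarrow> real" where
  "minima_sample X n \<omega> = (\<lambda>i\<in>{1..n}. min (fst (X i \<omega>)) (snd (X i \<omega>)))"

text \<open>The convention c(t) = c at index floor t, for t = n/k.\<close>

definition at_ratio :: "(nat \<Rightarrow> real) \<Rightarrow> nat \<Rightarrow> nat \<Rightarrow> real" where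
  "at_ratio c n k = c (nat \<lfloor>real n / real k\<rfloor>)"

end

theory Submission
  imports Defs "HOL-Real_Asymp.Real_Asymp"
begin

text \<open>
  Since the limit is deterministic, it suffices to show that the integral of each
  \<open>f \<in> Ck_plus E0\<close> converges in probability. With the true constants \<open>c (n/k)\<close>, \<open>d (n/k)\<close> this is
  Chebyshev's inequality: the mean of the integral tends to that of the limit by the tail
  condition, and its variance is \<open>O(1/k)\<close>. Passing to the estimators turns a normalized point
  \<open>y\<close> into \<open>a (y + b)\<close> with \<open>a\<close> close to 1 and \<open>b\<close> close to 0. As the extended plane is compact,
  this changes \<open>f\<close> uniformly little, and only on a slightly larger compact set, so the change is
  at most \<open>\<epsilon>\<close> times a fixed \<open>g \<in> Ck_plus E0\<close> whose integral is bounded in probability.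
\<close>

section \<open>Integrals against restricted image measures\<close>

text \<open>A test function is constrained only on \<open>E\<close>, while sample points may fall
  outside \<open>E\<close>. Its zero extension is defined at every point and discards exactly those
  points.\<close>

definition zero_extension :: "'a set \<Rightarrow> ('a \<Rightarrow> real) \<Rightarrow> 'a \<Rightarrow> real" where
  "zero_extension E f x = (if x \<in> E then f x else 0)"

text \<open>If \<open>K\<close> is the compact set carrying \<open>f\<close>, then \<open>E\<close>
  and \<open>- K\<close> form an open cover of the space, since compact sets are closed in a
  Hausdorff space. The extension equals \<open>f\<close> on \<open>E\<close> and vanishes on
  \<open>- K\<close>.\<close>

lemma continuous_on_zero_extension:
  fixes f :: "'a::t2_space \<Rightarrow> real"
  assumes "open E" "f \<in> Ck_plus E"
  shows "continuous_on UNIV (zero_extension E f)"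
proof -
  obtain K where K: "compact K" "K \<subseteq> E" "\<forall>x\<in>E - K. f x = 0"
    using assms(2) by (auto simp: Ck_plus_def)
  have "continuous_on E (zero_extension E f)"
    using assms(2) by (auto simp: Ck_plus_def zero_extension_def cong: continuous_on_cong)
  moreover have "continuous_on (- K) (zero_extension E f)"
  proof (rule continuous_on_eq[OF continuous_on_const])
    show "0 = zero_extension E f x" if "x \<in> - K" for x
      using that K(3) by (simp add: zero_extension_def)
  qed
  moreover have "open (- K)"
    using K(1) by (simp add: compact_imp_closed open_Compl)
  ultimately have "continuous_on (E \<union> - K) (zero_extension E f)"
    using assms(1) by (intro continuous_on_open_Un)
  moreover have "E \<union> - K = UNIV"
    using K(2) by auto
  ultimately show ?thesis
    by simp
qed

lemma zero_extension_nonneg: "f \<in> Ck_plus E \<Longrightarrow> 0 \<le> zero_extension E f x"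
  by (simp add: Ck_plus_def zero_extension_def)

lemma zero_extension_bounded:
  assumes "f \<in> Ck_plus E"
  obtains B where "\<And>x. zero_extension E f x \<le> B"
proof -
  obtain K where K: "compact K" "K \<subseteq> E" "\<forall>x\<in>E - K. f x = 0"
    using assms by (auto simp: Ck_plus_def)
  have "continuous_on K f"
    using assms K(2) by (auto simp: Ck_plus_def intro: continuous_on_subset)
  then have "bounded (f ` K)"
    by (intro compact_imp_bounded compact_continuous_image K)
  then obtain B where B: "0 < B" "\<forall>x\<in>K. norm (f x) \<le> B"
    by (auto simp: bounded_pos)
  have "zero_extension E f x \<le> B" for x
    using B K(3) by (cases "x \<in> K") (auto simp: zero_extension_def)
  then show ?thesis
    by (rule that)
qed

text \<open>One formula serves both the tail measures (\<open>N\<close> a probability measure) and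
  the empirical measures (\<open>N\<close> a counting measure). Because \<open>f\<close> is
  nonnegative, scaling is carried out on the nonnegative integral, so integrability never has to be
  checked: an infinite value becomes 0 under \<open>enn2real\<close>, as for the Bochner
  integral.\<close>

lemma integral_scale_restrict_distr:
  assumes E: "E \<in> sets borel" and Y: "Y \<in> borel_measurable N" and r: "0 \<le> r"
    and f: "f \<in> Ck_plus E"
  shows "(\<integral>x. f x \<partial>scale_measure (ennreal r) (restrict_space (distr N borel Y) E)) =
    r * (\<integral>\<omega>. zero_extension E f (Y \<omega>) \<partial>N)"
proof -
  let ?R = "restrict_space (distr N borel Y) E"
  have f_nonneg: "0 \<le> f x" if "x \<in> E" for x
    using f that by (simp add: Ck_plus_def)
  have [measurable]: "f \<in> borel_measurable (restrict_space borel E)"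
    using f by (auto simp: Ck_plus_def intro: borel_measurable_continuous_on_restrict)
  have ze: "zero_extension E f = (\<lambda>x. indicator E x *\<^sub>R f x)"
    by (auto simp: zero_extension_def fun_eq_iff)
  have [measurable]: "zero_extension E f \<in> borel_measurable borel"
    unfolding ze by (subst borel_measurable_restrict_space_iff[symmetric]) (use E in auto)
  have sets_R: "sets ?R = sets (restrict_space borel E)"
    by (simp add: sets_restrict_space)
  have meas: "f \<in> borel_measurable ?R"
    by (subst measurable_cong_sets[OF sets_R refl]) simp
  have AE_R: "AE x in ?R. 0 \<le> f x"
    using f_nonneg by (intro AE_I2) (simp add: space_restrict_space)
  have "(\<integral>x. f x \<partial>scale_measure (ennreal r) ?R) =
      enn2real (\<integral>\<^sup>+x. ennreal (f x) \<partial>scale_measure (ennreal r) ?R)"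
    using meas f_nonneg
    by (intro integral_eq_nn_integral AE_I2)
      (auto simp: space_scale_measure space_restrict_space cong: measurable_cong_sets)
  also have "\<dots> = r * enn2real (\<integral>\<^sup>+x. ennreal (f x) \<partial>?R)"
    using meas r by (subst nn_integral_scale_measure) (auto simp: enn2real_mult)
  also have "enn2real (\<integral>\<^sup>+x. ennreal (f x) \<partial>?R) = (\<integral>x. f x \<partial>?R)"
    by (rule integral_eq_nn_integral[OF meas AE_R, symmetric])
  also have "\<dots> = (\<integral>x. zero_extension E f x \<partial>distr N borel Y)"
    using E by (subst integral_restrict_space) (simp_all add: ze)
  also have "\<dots> = (\<integral>\<omega>. zero_extension E f (Y \<omega>) \<partial>N)"
    using Y by (intro integral_distr) auto
  finally show ?thesis .
qed

text \<open>The sum of point masses is the image of the counting measure on the indices: the mass of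
  \<open>A\<close> counts the \<open>i\<close> with \<open>x i\<close> in \<open>A\<close>. For
  \<open>k = 0\<close> both sides are the zero measure, since \<open>1 / 0 = 0\<close>.\<close>

lemma empirical_measure_eq_scale_restrict_distr:
  assumes E: "E \<in> sets borel"
  shows "empirical_measure E k n x =
    scale_measure (ennreal (1 / real k)) (restrict_space (distr (count_space {1..n}) borel x) E)"
proof (rule measure_eqI)
  fix A assume "A \<in> sets (empirical_measure E k n x)"
  then have A: "A \<in> sets (restrict_space borel E)"
    by simp
  then have "A \<subseteq> E" "A \<in> sets borel"
    using E by (auto simp: sets_restrict_space_iff)
  then have "emeasure (restrict_space (distr (count_space {1..n}) borel x) E) A =
      of_nat (card (x -` A \<inter> {1..n}))"
    using E by (simp add: emeasure_restrict_space emeasure_distr emeasure_count_space)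
  also have "\<dots> = (\<Sum>i=1..n. indicator A (x i))"
    by (simp add: indicator_def sum.If_cases Int_commute vimage_def)
  finally show "emeasure (empirical_measure E k n x) A = emeasure
      (scale_measure (ennreal (1 / real k)) (restrict_space (distr (count_space {1..n}) borel x) E)) A"
    using A by (simp add: emeasure_empirical_measure)
qed (simp add: sets_restrict_space)

lemma integral_empirical_measure:
  assumes "E \<in> sets borel" "f \<in> Ck_plus E"
  shows "(\<integral>y. f y \<partial>empirical_measure E k n x) = (\<Sum>i=1..n. zero_extension E f (x i)) / real k"
  using assms
  by (simp add: empirical_measure_eq_scale_restrict_distr integral_scale_restrict_distr
      lebesgue_integral_count_space_finite)

lemma empirical_measure_in_radon_measures: "empirical_measure E k n x \<in> radon_measures E"
proof -
  \<comment> \<open>The total mass is finite, so the bound holds for all sets and not only for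
    compact ones; a nonmeasurable set has \<open>emeasure\<close> 0 by convention.\<close>
  have "emeasure (empirical_measure E k n x) A < \<infinity>" for A
  proof (cases "A \<in> sets (empirical_measure E k n x)")
    case True
    have "(\<Sum>i=1..n. indicator A (x i) :: ennreal) < top"
      by (simp add: ennreal_indicator[symmetric] del: ennreal_indicator)
    with True show ?thesis
      by (simp add: emeasure_empirical_measure ennreal_mult_less_top)
  qed (simp add: emeasure_notin_sets)
  then show ?thesis
    by (simp add: radon_measures_def)
qed

section \<open>The vague topology\<close>

lemma openin_vague_topology_integral:
  assumes "f \<in> Ck_plus E" "open U"
  shows "openin (vague_topology E) {\<mu> \<in> radon_measures E. (\<integral>x. f x \<partial>\<mu>) \<in> U}"
  unfolding vague_topology_def by (rule topology_generated_by_Basis) (use assms in blast)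

lemma limitin_vague_topology_integral:
  assumes "limitin (vague_topology E) \<mu> \<nu> F" "f \<in> Ck_plus E"
  shows "((\<lambda>n. \<integral>x. f x \<partial>\<mu> n) \<longlongrightarrow> (\<integral>x. f x \<partial>\<nu>)) F"
proof (rule topological_tendstoI)
  fix U :: "real set" assume "open U" "(\<integral>x. f x \<partial>\<nu>) \<in> U"
  with assms have "\<forall>\<^sub>F n in F. \<mu> n \<in> {\<mu> \<in> radon_measures E. (\<integral>x. f x \<partial>\<mu>) \<in> U}"
    unfolding limitin_def by (auto dest!: openin_vague_topology_integral)
  then show "\<forall>\<^sub>F n in F. (\<integral>x. f x \<partial>\<mu> n) \<in> U"
    by (rule eventually_mono) simp
qed

text \<open>
  Measurability of the random measures is derived from continuity in the sample points; this avoids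
  proving that the vague topology is second countable.
\<close>

lemma continuous_map_empirical_measure:
  fixes E :: "'a::{t2_space, second_countable_topology} set"
  assumes "open E"
  shows "continuous_map euclidean (vague_topology E) (empirical_measure E k n)"
  unfolding vague_topology_def continuous_on_generated_topo_iff
proof (intro conjI allI impI)
  fix U assume "U \<in> {{\<mu> \<in> radon_measures E. (\<integral>x. f x \<partial>\<mu>) \<in> V} | f V. f \<in> Ck_plus E \<and> open V}"
  then obtain f V where U: "U = {\<mu> \<in> radon_measures E. (\<integral>x. f x \<partial>\<mu>) \<in> V}"
    and f: "f \<in> Ck_plus E" and V: "open V"
    by blast
  \<comment> \<open>Only finitely many coordinates of the sequence \<open>x\<close> enter, so
    continuity in the product topology is that of a finite sum. Multiplying by
    \<open>1 / real k\<close> instead of dividing keeps this valid for \<open>k = 0\<close>.\<close>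
  let ?I = "\<lambda>x :: nat \<Rightarrow> 'a. (\<Sum>i=1..n. zero_extension E f (x i)) * (1 / real k)"
  have "continuous_on UNIV (\<lambda>x :: nat \<Rightarrow> 'a. zero_extension E f (x i))" for i
    by (rule continuous_on_compose2[OF continuous_on_zero_extension[OF assms f]])
      (auto intro!: continuous_on_product_coordinates)
  then have "continuous_on UNIV ?I"
    by (intro continuous_intros)
  with V have "open (?I -` V)"
    by (rule open_vimage)
  moreover have "empirical_measure E k n -` U \<inter> topspace euclidean = ?I -` V"
    using f assms empirical_measure_in_radon_measures by (auto simp: U integral_empirical_measure)
  ultimately show "openin euclidean (empirical_measure E k n -` U \<inter> topspace euclidean)"
    by simp
next
  have "empirical_measure E k n x \<in> topspace (vague_topology E)" for x
    by (simp add: empirical_measure_in_radon_measures)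
  then show "empirical_measure E k n ` topspace euclidean
      \<subseteq> \<Union> {{\<mu> \<in> radon_measures E. (\<integral>x. f x \<partial>\<mu>) \<in> U} |f U. f \<in> Ck_plus E \<and> open U}"
    unfolding vague_topology_def topology_generated_by_topspace by blast
qed

lemma continuous_map_imp_measurable_borel_sets_of:
  assumes "continuous_map euclidean T g"
  shows "g \<in> measurable borel (borel_sets_of T)"
  unfolding borel_sets_of_def
proof (rule measurable_measure_of)
  show "g \<in> space borel \<rightarrow> topspace T"
    using continuous_map_image_subset_topspace[OF assms] by auto
  show "{U. openin T U} \<subseteq> Pow (topspace T)"
    by (auto dest: openin_subset)
  show "g -` U \<inter> space borel \<in> sets borel" if "U \<in> {U. openin T U}" for U
    using openin_continuous_map_preimage[OF assms, of U] that by (auto simp: vimage_def)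
qed

text \<open>Second countability turns measurability of each coordinate into Borel measurability of
  the whole sequence of points; composing with the continuous map above then gives the
  claim.\<close>

lemma measurable_empirical_measure:
  fixes E :: "'a::{t2_space, second_countable_topology} set"
  assumes "open E" "\<And>i. (\<lambda>\<omega>. Y \<omega> i) \<in> borel_measurable M"
  shows "(\<lambda>\<omega>. empirical_measure E k n (Y \<omega>)) \<in> measurable M (borel_sets_of (vague_topology E))"
  by (rule measurable_compose[of Y M borel])
    (use assms in \<open>auto intro!: measurable_coordinatewise_then_product
      continuous_map_imp_measurable_borel_sets_of continuous_map_empirical_measure\<close>)

section \<open>Weak convergence to a deterministic limit\<close>

lemma openin_imp_sets_borel_sets_of:
  assumes "openin T U"
  shows "U \<in> sets (borel_sets_of T)"
  unfolding borel_sets_of_def using assms openin_subset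
  by (subst sets_measure_of) auto

lemma space_borel_sets_of [simp]: "space (borel_sets_of T) = topspace T"
  unfolding borel_sets_of_def using openin_subset by (subst space_measure_of) auto

text \<open>A bounded continuous \<open>F\<close> is nearly constant on a neighbourhood
  \<open>U\<close> of \<open>z\<close>; outside \<open>U\<close> its oscillation is bounded and the
  probability is small. The argument works in an arbitrary topological space.\<close>

lemma converges_weakly_constI:
  assumes "prob_space M"
    and Y: "\<And>n. Y n \<in> measurable M (borel_sets_of T)" and z: "z \<in> topspace T"
    and lim: "\<And>U. openin T U \<Longrightarrow> z \<in> U \<Longrightarrow>
      (\<lambda>n. measure M {\<omega> \<in> space M. Y n \<omega> \<notin> U}) \<longlonglongrightarrow> 0"
  shows "converges_weakly M T Y (\<lambda>_. z)"
  unfolding converges_weakly_def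
proof (intro conjI allI impI)
  interpret prob_space M by fact
  fix F assume F: "continuous_map T euclideanreal F \<and> bounded (F ` topspace T)"
  then obtain B where B: "0 < B" "\<And>y. y \<in> topspace T \<Longrightarrow> \<bar>F y\<bar> \<le> B"
    by (force simp: bounded_pos)
  have Y_top: "Y n \<omega> \<in> topspace T" if "\<omega> \<in> space M" for n \<omega>
    using measurable_space[OF Y that] by simp
  have F_Y [measurable]: "(\<lambda>\<omega>. F (Y n \<omega>)) \<in> borel_measurable M" for n
  proof (rule borel_measurableI)
    fix V :: "real set" assume "open V"
    then have "openin T {y \<in> topspace T. F y \<in> V}"
      using F openin_continuous_map_preimage[of T euclideanreal F V] by simp
    then have "Y n -` {y \<in> topspace T. F y \<in> V} \<inter> space M \<in> sets M"
      by (intro measurable_sets[OF Y] openin_imp_sets_borel_sets_of)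
    also have "Y n -` {y \<in> topspace T. F y \<in> V} \<inter> space M = (\<lambda>\<omega>. F (Y n \<omega>)) -` V \<inter> space M"
      using Y_top by auto
    finally show "(\<lambda>\<omega>. F (Y n \<omega>)) -` V \<inter> space M \<in> sets M" .
  qed
  have int: "integrable M (\<lambda>\<omega>. F (Y n \<omega>))" for n
    using B Y_top by (intro integrable_const_bound[of _ B] AE_I2) auto
  show "(\<lambda>n. \<integral>\<omega>. F (Y n \<omega>) \<partial>M) \<longlonglongrightarrow> (\<integral>\<omega>. F z \<partial>M)"
  proof (rule LIMSEQ_I)
    fix e :: real assume "e > 0"
    define U where "U = {y \<in> topspace T. F y \<in> ball (F z) (e / 2)}"
    have U: "openin T U" "z \<in> U"
      using F openin_continuous_map_preimage[of T euclideanreal F "ball (F z) (e / 2)"] z \<open>e > 0\<close>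
      by (auto simp: U_def)
    let ?A = "\<lambda>n. {\<omega> \<in> space M. Y n \<omega> \<notin> U}"
    have A [measurable]: "?A n \<in> sets M" for n
    proof -
      have "?A n = space M - (Y n -` U \<inter> space M)"
        by auto
      then show ?thesis
        using measurable_sets[OF Y openin_imp_sets_borel_sets_of[OF U(1)]] by auto
    qed
    \<comment> \<open>Off \<open>U\<close> the difference is at most \<open>2 * B\<close>, so this
      threshold makes that contribution less than \<open>e / 2\<close>.\<close>
    have "\<forall>\<^sub>F n in sequentially. measure M (?A n) < e / (4 * B)"
      using \<open>e > 0\<close> B(1) by (intro order_tendstoD[OF lim[OF U]]) simp
    then obtain n0 where n0: "\<And>n. n \<ge> n0 \<Longrightarrow> measure M (?A n) < e / (4 * B)"
      by (auto simp: eventually_sequentially)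
    have "norm ((\<integral>\<omega>. F (Y n \<omega>) \<partial>M) - (\<integral>\<omega>. F z \<partial>M)) < e" if "n \<ge> n0" for n
    proof -
      have "norm ((\<integral>\<omega>. F (Y n \<omega>) \<partial>M) - (\<integral>\<omega>. F z \<partial>M)) = norm (\<integral>\<omega>. F (Y n \<omega>) - F z \<partial>M)"
        using int by simp
      also have "\<dots> \<le> (\<integral>\<omega>. norm (F (Y n \<omega>) - F z) \<partial>M)"
        by (rule integral_norm_bound)
      also have "\<dots> \<le> (\<integral>\<omega>. e / 2 + 2 * B * indicator (?A n) \<omega> \<partial>M)"
      proof (rule integral_mono)
        fix \<omega> assume "\<omega> \<in> space M"
        then have "\<bar>F (Y n \<omega>)\<bar> \<le> B" "\<bar>F z\<bar> \<le> B"
          using B z Y_top by auto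
        then show "norm (F (Y n \<omega>) - F z) \<le> e / 2 + 2 * B * indicator (?A n) \<omega>"
          using \<open>\<omega> \<in> space M\<close> \<open>e > 0\<close>
          by (auto simp: U_def dist_real_def indicator_def abs_minus_commute)
      qed (use int in \<open>auto intro!: integrable_add integrable_mult_right integrable_real_indicator
          simp: less_top[symmetric]\<close>)
      also have "\<dots> = e / 2 + 2 * B * measure M (?A n)"
        by (subst Bochner_Integration.integral_add)
          (auto simp: prob_space less_top[symmetric] intro!: integrable_mult_right integrable_real_indicator)
      also have "\<dots> < e / 2 + 2 * B * (e / (4 * B))"
        using n0[OF that] B(1) by (intro add_strict_left_mono mult_strict_left_mono) auto
      also have "\<dots> = e"
        using B(1) by simp
      finally show ?thesis .
    qed
    then show "\<exists>no. \<forall>n\<ge>no. norm ((\<integral>\<omega>. F (Y n \<omega>) \<partial>M) - (\<integral>\<omega>. F z \<partial>M)) < e"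
      by blast
  qed
qed (use Y z in auto)

lemma measurable_integral_vague:
  assumes Y: "Y \<in> measurable M (borel_sets_of (vague_topology E))" and f: "f \<in> Ck_plus E"
  shows "(\<lambda>\<omega>. \<integral>x. f x \<partial>Y \<omega>) \<in> borel_measurable M"
proof (rule borel_measurableI)
  fix V :: "real set" assume "open V"
  let ?U = "{\<mu> \<in> radon_measures E. (\<integral>x. f x \<partial>\<mu>) \<in> V}"
  have "Y -` ?U \<inter> space M \<in> sets M"
    by (intro measurable_sets[OF Y] openin_imp_sets_borel_sets_of
        openin_vague_topology_integral f \<open>open V\<close>)
  moreover have "Y -` ?U \<inter> space M = (\<lambda>\<omega>. \<integral>x. f x \<partial>Y \<omega>) -` V \<inter> space M"
    using measurable_space[OF Y] by auto
  ultimately show "(\<lambda>\<omega>. \<integral>x. f x \<partial>Y \<omega>) -` V \<inter> space M \<in> sets M"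
    by simp
qed

text \<open>The hypothesis controls only the generating sets of the topology. That neighbourhoods of
  \<open>\<nu>\<close> are left with vanishing probability passes to finite intersections by the
  union bound and to unions by monotonicity, so induction over the generated topology
  applies.\<close>

lemma converges_weakly_vague_constI:
  assumes "prob_space M"
    and Y: "\<And>n. Y n \<in> measurable M (borel_sets_of (vague_topology E))"
    and \<nu>: "\<nu> \<in> radon_measures E"
    and lim: "\<And>f. f \<in> Ck_plus E \<Longrightarrow>
      converges_in_prob M (\<lambda>n \<omega>. \<integral>x. f x \<partial>Y n \<omega>) (\<integral>x. f x \<partial>\<nu>)"
  shows "converges_weakly M (vague_topology E) Y (\<lambda>_. \<nu>)"
proof (rule converges_weakly_constI[OF assms(1) Y])
  interpret prob_space M by fact
  have Y_radon: "Y n \<omega> \<in> radon_measures E" if "\<omega> \<in> space M" for n \<omega>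
    using measurable_space[OF Y that] by simp
  have sets: "{\<omega> \<in> space M. Y n \<omega> \<notin> U} \<in> sets M" if "openin (vague_topology E) U" for n U
  proof -
    have "{\<omega> \<in> space M. Y n \<omega> \<notin> U} = space M - (Y n -` U \<inter> space M)"
      by auto
    then show ?thesis
      using measurable_sets[OF Y openin_imp_sets_borel_sets_of[OF that]] by auto
  qed
  let ?S = "{{\<mu> \<in> radon_measures E. (\<integral>x. f x \<partial>\<mu>) \<in> V} | f V. f \<in> Ck_plus E \<and> open V}"
  have openin_iff: "openin (vague_topology E) U \<longleftrightarrow> generate_topology_on ?S U" for U
    by (simp add: vague_topology_def openin_topology_generated_by_iff)
  fix U assume "openin (vague_topology E) U" "\<nu> \<in> U"
  then show "(\<lambda>n. measure M {\<omega> \<in> space M. Y n \<omega> \<notin> U}) \<longlonglongrightarrow> 0"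
    unfolding openin_iff
  proof (induction U)
    case Empty
    then show ?case by simp
  next
    case (Int a b)
    have "(\<lambda>n. measure M {\<omega> \<in> space M. Y n \<omega> \<notin> a} + measure M {\<omega> \<in> space M. Y n \<omega> \<notin> b}) \<longlonglongrightarrow> 0 + 0"
      using Int by (intro tendsto_add) auto
    then have sum: "(\<lambda>n. measure M {\<omega> \<in> space M. Y n \<omega> \<notin> a} + measure M {\<omega> \<in> space M. Y n \<omega> \<notin> b}) \<longlonglongrightarrow> 0"
      by simp
    show ?case
    proof (rule Lim_null_comparison[OF always_eventually sum], rule allI)
      fix n
      have "{\<omega> \<in> space M. Y n \<omega> \<notin> a \<inter> b} =
          {\<omega> \<in> space M. Y n \<omega> \<notin> a} \<union> {\<omega> \<in> space M. Y n \<omega> \<notin> b}"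
        by auto
      then show "norm (measure M {\<omega> \<in> space M. Y n \<omega> \<notin> a \<inter> b}) \<le>
          measure M {\<omega> \<in> space M. Y n \<omega> \<notin> a} + measure M {\<omega> \<in> space M. Y n \<omega> \<notin> b}"
        using Int.hyps by (simp add: measure_Un_le sets openin_iff)
    qed
  next
    case (UN K)
    \<comment> \<open>A single member containing \<open>\<nu>\<close> already bounds the exceptional
      event, hence unions of any cardinality are harmless.\<close>
    then obtain u where u: "u \<in> K" "\<nu> \<in> u"
      by auto
    show ?case
    proof (rule Lim_null_comparison[OF always_eventually UN.IH[OF u]], rule allI)
      fix n
      have "measure M {\<omega> \<in> space M. Y n \<omega> \<notin> \<Union> K} \<le> measure M {\<omega> \<in> space M. Y n \<omega> \<notin> u}"
        using u UN.hyps by (intro finite_measure_mono sets) (auto simp: openin_iff)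
      then show "norm (measure M {\<omega> \<in> space M. Y n \<omega> \<notin> \<Union> K}) \<le>
          measure M {\<omega> \<in> space M. Y n \<omega> \<notin> u}"
        by simp
    qed
  next
    case (Basis U)
    then obtain f V where U: "U = {\<mu> \<in> radon_measures E. (\<integral>x. f x \<partial>\<mu>) \<in> V}"
      and f: "f \<in> Ck_plus E" and V: "open V"
      by blast
    have "(\<integral>x. f x \<partial>\<nu>) \<in> V"
      using Basis.prems by (simp add: U)
    then obtain e where e: "e > 0" "ball (\<integral>x. f x \<partial>\<nu>) e \<subseteq> V"
      using V openE by blast
    let ?I = "\<lambda>n \<omega>. \<integral>x. f x \<partial>Y n \<omega>"
    note [measurable] = measurable_integral_vague[OF Y f]
    \<comment> \<open>Leaving the open ball gives only distance at least \<open>e\<close>, while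
      \<open>converges_in_prob\<close> uses a strict inequality; the radius \<open>e / 2\<close>
      bridges the two.\<close>
    have lim': "(\<lambda>n. measure M {\<omega> \<in> space M. \<bar>?I n \<omega> - (\<integral>x. f x \<partial>\<nu>)\<bar> > e / 2}) \<longlonglongrightarrow> 0"
      using e(1) by (intro lim[OF f, unfolded converges_in_prob_def, rule_format]) simp
    show ?case
    proof (rule Lim_null_comparison[OF always_eventually lim'], rule allI)
      fix n
      have "{\<omega> \<in> space M. Y n \<omega> \<notin> U} \<subseteq> {\<omega> \<in> space M. \<bar>?I n \<omega> - (\<integral>x. f x \<partial>\<nu>)\<bar> > e / 2}"
      proof clarsimp
        fix \<omega> assume \<omega>: "\<omega> \<in> space M" "Y n \<omega> \<notin> U"
        then have "?I n \<omega> \<notin> ball (\<integral>x. f x \<partial>\<nu>) e"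
          using e(2) Y_radon by (auto simp: U)
        then show "e < \<bar>?I n \<omega> - (\<integral>x. f x \<partial>\<nu>)\<bar> * 2"
          using e(1) by (auto simp: dist_real_def abs_minus_commute)
      qed
      then have "measure M {\<omega> \<in> space M. Y n \<omega> \<notin> U} \<le>
          measure M {\<omega> \<in> space M. \<bar>?I n \<omega> - (\<integral>x. f x \<partial>\<nu>)\<bar> > e / 2}"
        by (intro finite_measure_mono) auto
      then show "norm (measure M {\<omega> \<in> space M. Y n \<omega> \<notin> U}) \<le>
          measure M {\<omega> \<in> space M. \<bar>?I n \<omega> - (\<integral>x. f x \<partial>\<nu>)\<bar> > e / 2}"
        by simp
    qed
  qed
qed (use \<nu> in simp)

section \<open>Perturbation of test functions\<close>

text \<open>Both coordinates attain their minima on a nonempty \<open>K\<close>, and these exceed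
  \<open>l\<close>; a real number fits strictly between \<open>l\<close> and the smaller one, also
  when \<open>l\<close> is \<open>-\<infinity>\<close>.\<close>

lemma compact_subset_quadrant_lower_bound:
  fixes K :: "(ereal \<times> ereal) set" and l :: ereal
  assumes "compact K" "K \<subseteq> {l<..} \<times> {l<..}" "l < \<infinity>"
  obtains \<eta> :: real where "l < \<eta>" "\<And>x. x \<in> K \<Longrightarrow> ereal \<eta> < fst x \<and> ereal \<eta> < snd x"
proof (cases "K = {}")
  case True
  from ereal_dense2[OF assms(3)] obtain \<eta> where "l < ereal \<eta>"
    by blast
  with True show ?thesis
    by (intro that[of \<eta>]) auto
next
  case False
  have "compact (fst ` K)" "compact (snd ` K)"
    using assms(1) by (auto intro!: compact_continuous_image continuous_intros)
  with False obtain p q where p: "p \<in> fst ` K" "\<And>x. x \<in> fst ` K \<Longrightarrow> p \<le> x"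
    and q: "q \<in> snd ` K" "\<And>x. x \<in> snd ` K \<Longrightarrow> q \<le> x"
    by (metis compact_attains_inf image_is_empty)
  have "l < min p q"
    using p(1) q(1) assms(2) by auto
  from ereal_dense2[OF this] obtain \<eta> where \<eta>: "l < ereal \<eta>" "ereal \<eta> < min p q"
    by blast
  show ?thesis
  proof (rule that[OF \<eta>(1)])
    fix x assume "x \<in> K"
    then have "p \<le> fst x" "q \<le> snd x"
      using p(2) q(2) by auto
    with \<eta>(2) show "ereal \<eta> < fst x \<and> ereal \<eta> < snd x"
      by auto
  qed
qed

text \<open>The witness is a product of linear ramps rising from 0 at \<open>u\<close> to 1 at
  \<open>v\<close>. Its support lies in a closed quadrant, which is compact because the extended
  line is.\<close>

lemma Ck_plus_quadrant_cutoff: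
  fixes l :: ereal and u v :: real
  assumes "l < u" "u < v"
  obtains g where "g \<in> Ck_plus ({l<..} \<times> {l<..})" "\<And>x y :: ereal. ereal v \<le> x \<Longrightarrow> ereal v \<le> y \<Longrightarrow> g (x, y) = 1"
proof -
  \<comment> \<open>Clamping to the interval from \<open>u\<close> to \<open>v\<close> comes before
    the conversion to reals, so that \<open>real_of_ereal\<close> is applied only to finite values,
    where it is continuous.\<close>
  define \<psi> where "\<psi> t = (real_of_ereal (max u (min v t)) - u) / (v - u)" for t :: ereal
  have clamp_real: "max (ereal u) (min (ereal v) t) \<in> UNIV - {\<infinity>, -\<infinity>}" for t
    using assms(2) by (cases t) (auto simp: max_def min_def)
  have "continuous_on UNIV (\<lambda>t. real_of_ereal (max (ereal u) (min (ereal v) t)))"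
    by (rule continuous_on_compose2[OF continuous_on_real])
      (use clamp_real in \<open>auto intro!: continuous_on_max continuous_on_min continuous_intros\<close>)
  then have \<psi>_cont: "continuous_on UNIV \<psi>"
    unfolding \<psi>_def using assms(2) by (intro continuous_intros) auto
  have \<psi>_nonneg: "0 \<le> \<psi> t" for t
    using assms(2) by (cases t) (auto simp: \<psi>_def max_def min_def)
  have \<psi>_0: "ereal u \<le> t" if "\<psi> t \<noteq> 0" for t
    using assms(2) that by (cases t) (auto simp: \<psi>_def max_def min_def split: if_splits)
  have \<psi>_1: "\<psi> t = 1" if "ereal v \<le> t" for t
    using assms(2) that by (cases t) (auto simp: \<psi>_def max_def min_def)
  have "continuous_on ({l<..} \<times> {l<..}) (\<lambda>x. \<psi> (fst x) * \<psi> (snd x))"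
    by (intro continuous_intros continuous_on_compose2[OF \<psi>_cont]) auto
  moreover have "compact ({ereal u..} \<times> {ereal u..})"
    by (intro compact_Times) (simp_all add: compact_eq_closed)
  moreover have "{ereal u..} \<times> {ereal u..} \<subseteq> {l<..} \<times> {l<..}"
    using assms(1) by auto
  ultimately have "(\<lambda>x. \<psi> (fst x) * \<psi> (snd x)) \<in> Ck_plus ({l<..} \<times> {l<..})"
    unfolding Ck_plus_def using \<psi>_0 \<psi>_nonneg
    by (intro CollectI conjI exI[of _ "{ereal u..} \<times> {ereal u..}"]) auto
  then show ?thesis
    by (rule that) (simp add: \<psi>_1)
qed

text \<open>At \<open>(1, 0)\<close> the perturbation is the identity, and the difference is jointly
  continuous at each point over \<open>(1, 0)\<close>. The extended plane being compact, the tube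
  lemma gives one neighbourhood valid for all points.\<close>

lemma zero_extension_uniform_perturbation:
  fixes E :: "(ereal \<times> ereal) set"
  assumes "open E" "f \<in> Ck_plus E" "e > 0"
  obtains U :: "(real \<times> real) set" where "open U" "(1, 0) \<in> U"
    "\<And>a b and x y :: ereal. (a, b) \<in> U \<Longrightarrow>
      \<bar>zero_extension E f (ereal a * (x + ereal b), ereal a * (y + ereal b)) - zero_extension E f (x, y)\<bar> < e"
proof -
  let ?f = "zero_extension E f"
  let ?T = "\<lambda>p :: (real \<times> real) \<times> ereal \<times> ereal.
    (ereal (fst (fst p)) * (fst (snd p) + ereal (snd (fst p))),
     ereal (fst (fst p)) * (snd (snd p) + ereal (snd (fst p))))"
  \<comment> \<open>The interior is open by construction, so continuity of \<open>?T\<close> is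
    needed only over \<open>(1, 0)\<close>; elsewhere it can fail, for instance at products of 0 and
    \<open>\<infinity>\<close>.\<close>
  define W where "W = interior {p. \<bar>?f (?T p) - ?f (snd p)\<bar> < e}"
  have f_tendsto: "((\<lambda>p. ?f (u p)) \<longlongrightarrow> ?f z) F" if "(u \<longlongrightarrow> z) F"
    for u :: "_ \<Rightarrow> ereal \<times> ereal" and z F
    using continuous_on_tendsto_compose[OF continuous_on_zero_extension[OF assms(1,2)] that] by simp
  have in_W: "((1, 0), z) \<in> W" for z :: "ereal \<times> ereal"
  proof -
    let ?F = "nhds (((1::real), (0::real)), z)"
    have id: "((\<lambda>p. p) \<longlongrightarrow> ((1, 0), z)) ?F"
      by (rule filterlim_ident)
    \<comment> \<open>Adding 0 and multiplying by 1 avoid the indeterminate forms of extended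
      arithmetic, even if \<open>z\<close> has infinite coordinates.\<close>
    have "(?T \<longlongrightarrow> (ereal 1 * (fst z + ereal 0), ereal 1 * (snd z + ereal 0))) ?F"
      using tendsto_fst[OF id] tendsto_snd[OF id]
      by (intro tendsto_Pair tendsto_mult_ereal tendsto_add_ereal_general tendsto_ereal)
        (auto dest: tendsto_fst tendsto_snd)
    then have "(?T \<longlongrightarrow> z) ?F"
      by (simp add: one_ereal_def[symmetric] zero_ereal_def[symmetric])
    then have "((\<lambda>p. ?f (?T p) - ?f (snd p)) \<longlongrightarrow> ?f z - ?f z) ?F"
      using tendsto_snd[OF id] by (intro tendsto_diff f_tendsto) auto
    from tendstoD[OF this assms(3)] show ?thesis
      by (auto simp: W_def dist_real_def eventually_nhds intro!: interiorI)
  qed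
  have "open W"
    by (simp add: W_def)
  moreover have "compact (UNIV :: (ereal \<times> ereal) set)"
    using compact_Times[OF compact_UNIV[where 'a = ereal] compact_UNIV[where 'a = ereal]] by simp
  moreover have "{(1, 0)} \<times> UNIV \<subseteq> W"
    using in_W by auto
  ultimately obtain U where U: "(1, 0) \<in> U" "open U" "U \<times> UNIV \<subseteq> W"
    using Elementary_Topology.tube_lemma[of UNIV W "(1, 0)"] by blast
  show ?thesis
  proof (rule that[OF U(2,1)])
    fix a b x y assume "(a, b) \<in> U"
    then have "((a, b), (x, y)) \<in> W"
      using U(3) by blast
    then show "\<bar>?f (ereal a * (x + ereal b), ereal a * (y + ereal b)) - ?f (x, y)\<bar> < e"
      unfolding W_def using interior_subset by fastforce
  qed
qed

text \<open>If both coordinates are at least \<open>v\<close>, then \<open>g\<close> is 1 and the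
  uniform bound applies. Otherwise a small perturbation leaves some coordinate at most
  \<open>\<eta>\<close>, where \<open>f\<close> vanishes before and after. The function
  \<open>g\<close> is chosen before \<open>e\<close>, so the bound on its integral does not depend
  on \<open>e\<close>.\<close>

lemma zero_extension_quadrant_perturbation:
  fixes l :: ereal and f :: "ereal \<times> ereal \<Rightarrow> real"
  defines "E \<equiv> {l<..} \<times> {l<..}"
  assumes "l < \<infinity>" and f: "f \<in> Ck_plus E"
  obtains g where "g \<in> Ck_plus E"
    "\<And>e. e > 0 \<Longrightarrow> \<exists>\<delta>>0. \<forall>a b x y. \<bar>a - 1\<bar> \<le> \<delta> \<longrightarrow> \<bar>b\<bar> \<le> \<delta> \<longrightarrow>
      \<bar>zero_extension E f (ereal (a * (x + b)), ereal (a * (y + b))) - zero_extension E f (ereal x, ereal y)\<bar>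
        \<le> e * zero_extension E g (ereal x, ereal y)"
proof -
  let ?f = "zero_extension E f"
  have "open E"
    by (simp add: E_def open_Times)
  obtain K where K: "compact K" "K \<subseteq> E" "\<forall>x\<in>E - K. f x = 0"
    using f by (auto simp: Ck_plus_def)
  obtain \<eta> :: real where \<eta>: "l < ereal \<eta>" "\<And>x. x \<in> K \<Longrightarrow> ereal \<eta> < fst x \<and> ereal \<eta> < snd x"
    using compact_subset_quadrant_lower_bound[of K l] K assms(2) by (auto simp: E_def)
  obtain v where v: "l < ereal v" "v < \<eta>"
    using ereal_dense2[OF \<eta>(1)] by auto
  obtain u where u: "l < ereal u" "u < v"
    using ereal_dense2[OF v(1)] by auto
  obtain g where g: "g \<in> Ck_plus E" "\<And>x y :: ereal. ereal v \<le> x \<Longrightarrow> ereal v \<le> y \<Longrightarrow> g (x, y) = 1"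
    using Ck_plus_quadrant_cutoff[OF u] by (auto simp: E_def)
  have f_0: "?f (ereal x, ereal y) = 0" if "x \<le> \<eta> \<or> y \<le> \<eta>" for x y
  proof -
    have "(ereal x, ereal y) \<notin> K"
      using \<eta>(2)[of "(ereal x, ereal y)"] that by auto
    with K(3) show ?thesis
      by (simp add: zero_extension_def)
  qed
  show ?thesis
  proof (rule that[OF g(1)])
    fix e :: real assume "e > 0"
    obtain U :: "(real \<times> real) set" where U: "open U" "(1, 0) \<in> U"
      "\<And>a b and x y :: ereal. (a, b) \<in> U \<Longrightarrow>
        \<bar>?f (ereal a * (x + ereal b), ereal a * (y + ereal b)) - ?f (x, y)\<bar> < e"
      using zero_extension_uniform_perturbation[OF \<open>open E\<close> f \<open>e > 0\<close>] by blast
    \<comment> \<open>Positivity of \<open>a\<close> makes the perturbation monotone in each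
      coordinate, so the condition at \<open>v\<close> controls every coordinate below
      \<open>v\<close>. At \<open>(1, 0)\<close> it reads \<open>v < \<eta>\<close>.\<close>
    define V where "V = U \<inter> {p. 0 < fst p} \<inter> {p. fst p * (v + snd p) < \<eta>}"
    have "open V"
      unfolding V_def by (intro open_Int U open_Collect_less continuous_intros)
    moreover have "(1, 0) \<in> V"
      using U(2) v(2) by (simp add: V_def)
    ultimately obtain A B where AB: "open A" "open B" "(1, 0) \<in> A \<times> B" "A \<times> B \<subseteq> V"
      by (rule open_prod_elim)
    \<comment> \<open>Closed balls match the non-strict bounds on \<open>a\<close> and
      \<open>b\<close>, which are the complements of the strict events in
      \<open>converges_in_prob\<close>.\<close>
    obtain r where r: "r > 0" "cball 1 r \<subseteq> A"
      using AB open_contains_cball by blast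
    obtain s where s: "s > 0" "cball 0 s \<subseteq> B"
      using AB open_contains_cball by blast
    have "\<bar>?f (ereal (a * (x + b)), ereal (a * (y + b))) - ?f (ereal x, ereal y)\<bar>
        \<le> e * zero_extension E g (ereal x, ereal y)"
      if ab: "\<bar>a - 1\<bar> \<le> min r s" "\<bar>b\<bar> \<le> min r s" for a b x y
    proof -
      have "a \<in> cball 1 r" "b \<in> cball 0 s"
        using ab by (auto simp: dist_real_def)
      then have "(a, b) \<in> V"
        using r(2) s(2) AB(4) by blast
      then have "(a, b) \<in> U" "0 < a" and less_\<eta>: "a * (v + b) < \<eta>"
        by (auto simp: V_def)
      show ?thesis
      proof (cases "v \<le> x \<and> v \<le> y")
        case True
        then have "l < ereal x" "l < ereal y"
          using v(1) by (auto intro: less_le_trans)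
        with True g(2) have "zero_extension E g (ereal x, ereal y) = 1"
          by (simp add: zero_extension_def E_def)
        with U(3)[OF \<open>(a, b) \<in> U\<close>, of "ereal x" "ereal y"] show ?thesis
          by simp
      next
        case False
        have "a * (z + b) \<le> \<eta>" if "z < v" for z
        proof -
          have "a * (z + b) \<le> a * (v + b)"
            using that \<open>0 < a\<close> by (intro mult_left_mono) auto
          with less_\<eta> show ?thesis
            by simp
        qed
        with False have "?f (ereal (a * (x + b)), ereal (a * (y + b))) = 0"
          by (intro f_0) auto
        moreover have "?f (ereal x, ereal y) = 0"
          using False v(2) by (intro f_0) auto
        ultimately show ?thesis
          using zero_extension_nonneg[OF g(1)] \<open>e > 0\<close> by simp
      qed
    qed
    moreover have "min r s > 0"
      using r(1) s(1) by simp
    ultimately show "\<exists>\<delta>>0. \<forall>a b x y. \<bar>a - 1\<bar> \<le> \<delta> \<longrightarrow> \<bar>b\<bar> \<le> \<delta> \<longrightarrow>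
        \<bar>?f (ereal (a * (x + b)), ereal (a * (y + b))) - ?f (ereal x, ereal y)\<bar>
          \<le> e * zero_extension E g (ereal x, ereal y)"
      by blast
  qed
qed

section \<open>A weak law for triangular arrays\<close>

text \<open>Independence removes the cross terms, and each diagonal term is at most the mean of the
  squared \<open>h\<close>, hence at most \<open>B * \<mu>\<close>. Linearity in
  \<open>\<mu>\<close> is essential: for rare events \<open>\<mu>\<close> is small, and a bound by
  \<open>B\<^sup>2\<close> would be too weak.\<close>

lemma (in prob_space) second_moment_iid_sum:
  fixes X :: "nat \<Rightarrow> 'a \<Rightarrow> 'b::topological_space" and h :: "'b \<Rightarrow> real"
    and \<mu> :: real
  assumes X: "indep_vars (\<lambda>_. borel) X UNIV"
    and distr_X: "\<And>i. distr M borel (X i) = distr M borel (X 0)"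
    and h [measurable]: "h \<in> borel_measurable borel"
    and bound: "\<And>x. 0 \<le> h x" "\<And>x. h x \<le> B"
    and I: "finite I"
  defines "\<mu> \<equiv> expectation (\<lambda>\<omega>. h (X 0 \<omega>))"
  shows "expectation (\<lambda>\<omega>. ((\<Sum>i\<in>I. h (X i \<omega>)) - card I * \<mu>)\<^sup>2) \<le> card I * (B * \<mu>)"
proof -
  have X_meas [measurable]: "X i \<in> borel_measurable M" for i
    using X by (auto simp: indep_vars_def)
  have transfer: "expectation (\<lambda>\<omega>. u (X i \<omega>)) = expectation (\<lambda>\<omega>. u (X 0 \<omega>))"
    if "u \<in> borel_measurable borel" for u :: "'b \<Rightarrow> real" and i
    using integral_distr[OF X_meas that, of i] integral_distr[OF X_meas that, of 0] distr_X[of i]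
    by simp
  have int_h: "integrable M (\<lambda>\<omega>. h (X i \<omega>))" for i
    using bound by (intro integrable_const_bound[of _ B] AE_I2) auto
  define Z where "Z i \<omega> = h (X i \<omega>) - \<mu>" for i \<omega>
  have [measurable]: "Z i \<in> borel_measurable M" for i
    unfolding Z_def by measurable
  have Z_bound: "\<bar>Z i \<omega>\<bar> \<le> B + \<bar>\<mu>\<bar>" for i \<omega>
    using bound[of "X i \<omega>"] unfolding Z_def by linarith
  have int_Z: "integrable M (Z i)" for i
    using Z_bound by (intro integrable_const_bound[of _ "B + \<bar>\<mu>\<bar>"] AE_I2) auto
  have int_ZZ: "integrable M (\<lambda>\<omega>. Z i \<omega> * Z j \<omega>)" for i j
    using Z_bound by (intro integrable_const_bound[of _ "(B + \<bar>\<mu>\<bar>) * (B + \<bar>\<mu>\<bar>)"] AE_I2)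
      (auto simp: abs_mult intro!: mult_mono order_trans[OF abs_ge_zero Z_bound])
  have E_Z: "expectation (Z i) = 0" for i
    using int_h transfer[OF h, of i] by (simp add: Z_def[abs_def] \<mu>_def prob_space)
  have indep_Z: "indep_vars (\<lambda>_. borel) Z UNIV"
    unfolding Z_def by (rule indep_vars_compose2[OF X]) measurable
  have uncorrelated: "expectation (\<lambda>\<omega>. Z i \<omega> * Z j \<omega>) = 0" if "i \<noteq> j" for i j
  proof -
    have "expectation (\<lambda>\<omega>. \<Prod>l\<in>{i, j}. Z l \<omega>) = (\<Prod>l\<in>{i, j}. expectation (Z l))"
      by (rule indep_vars_lebesgue_integral) (auto intro: indep_vars_subset[OF indep_Z] int_Z)
    with that E_Z show ?thesis
      by simp
  qed
  have int_h2: "integrable M (\<lambda>\<omega>. (h (X i \<omega>))\<^sup>2)" for i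
    using bound by (intro integrable_const_bound[of _ "B\<^sup>2"] AE_I2) (auto intro!: power_mono)
  have diag: "expectation (\<lambda>\<omega>. Z i \<omega> * Z i \<omega>) \<le> B * \<mu>" for i
  proof -
    have "(\<lambda>\<omega>. Z i \<omega> * Z i \<omega>) = (\<lambda>\<omega>. (h (X i \<omega>))\<^sup>2 - 2 * \<mu> * h (X i \<omega>) + \<mu>\<^sup>2)"
      by (auto simp: Z_def power2_eq_square algebra_simps)
    then have "expectation (\<lambda>\<omega>. Z i \<omega> * Z i \<omega>) = expectation (\<lambda>\<omega>. (h (X i \<omega>))\<^sup>2) - \<mu>\<^sup>2"
      using int_h int_h2 transfer[OF h, of i]
      by (simp add: \<mu>_def[symmetric] prob_space power2_eq_square)
    also have "\<dots> \<le> expectation (\<lambda>\<omega>. (h (X i \<omega>))\<^sup>2)"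
      by simp
    also have "\<dots> \<le> expectation (\<lambda>\<omega>. B * h (X i \<omega>))"
      using int_h int_h2 bound
      by (intro integral_mono) (auto simp: power2_eq_square intro!: mult_right_mono)
    also have "\<dots> = B * \<mu>"
      using transfer[OF h, of i] by (simp add: \<mu>_def)
    finally show ?thesis .
  qed
  have "(\<Sum>i\<in>I. h (X i \<omega>)) - card I * \<mu> = (\<Sum>i\<in>I. Z i \<omega>)" for \<omega>
    by (simp add: Z_def sum_subtractf)
  then have "expectation (\<lambda>\<omega>. ((\<Sum>i\<in>I. h (X i \<omega>)) - card I * \<mu>)\<^sup>2) =
      expectation (\<lambda>\<omega>. \<Sum>i\<in>I. \<Sum>j\<in>I. Z i \<omega> * Z j \<omega>)"
    by (simp add: power2_eq_square sum_product)
  also have "\<dots> = (\<Sum>i\<in>I. \<Sum>j\<in>I. expectation (\<lambda>\<omega>. Z i \<omega> * Z j \<omega>))"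
    using int_ZZ by simp
  also have "\<dots> = (\<Sum>i\<in>I. expectation (\<lambda>\<omega>. Z i \<omega> * Z i \<omega>))"
  proof (rule sum.cong[OF refl])
    fix i assume "i \<in> I"
    have "(\<Sum>j\<in>I. expectation (\<lambda>\<omega>. Z i \<omega> * Z j \<omega>)) =
        (\<Sum>j\<in>I. if i = j then expectation (\<lambda>\<omega>. Z i \<omega> * Z i \<omega>) else 0)"
      by (intro sum.cong) (auto simp: uncorrelated)
    with I \<open>i \<in> I\<close> show "(\<Sum>j\<in>I. expectation (\<lambda>\<omega>. Z i \<omega> * Z j \<omega>)) =
        expectation (\<lambda>\<omega>. Z i \<omega> * Z i \<omega>)"
      by simp
  qed
  also have "\<dots> \<le> card I * (B * \<mu>)"
    using sum_bounded_above[of I _ "B * \<mu>"] diag by simp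
  finally show ?thesis .
qed

text \<open>The normalized sum has mean tending to \<open>L\<close>, and its variance is at most
  \<open>B / k n\<close> times that mean, which tends to 0. Chebyshev's inequality finishes.\<close>

lemma (in prob_space) weak_law_rare_events:
  fixes X :: "nat \<Rightarrow> 'a \<Rightarrow> 'b::topological_space" and h :: "nat \<Rightarrow> 'b \<Rightarrow> real"
  assumes X: "indep_vars (\<lambda>_. borel) X UNIV"
    and distr_X: "\<And>i. distr M borel (X i) = distr M borel (X 0)"
    and h [measurable]: "\<And>n. h n \<in> borel_measurable borel"
    and bound: "\<And>n x. 0 \<le> h n x" "\<And>n x. h n x \<le> B"
    and k: "filterlim k at_top sequentially"
    and lim: "(\<lambda>n. real n / real (k n) * expectation (\<lambda>\<omega>. h n (X 0 \<omega>))) \<longlonglongrightarrow> L"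
  shows "converges_in_prob M (\<lambda>n \<omega>. (\<Sum>i=1..n. h n (X i \<omega>)) / real (k n)) L"
  unfolding converges_in_prob_def
proof (intro allI impI)
  fix e :: real assume e: "e > 0"
  have X_meas [measurable]: "X i \<in> borel_measurable M" for i
    using X by (auto simp: indep_vars_def)
  define \<mu> where "\<mu> n = expectation (\<lambda>\<omega>. h n (X 0 \<omega>))" for n
  define S where "S n \<omega> = (\<Sum>i=1..n. h n (X i \<omega>))" for n \<omega>
  have [measurable]: "S n \<in> borel_measurable M" for n
    unfolding S_def by measurable
  have int_h: "integrable M (\<lambda>\<omega>. h n (X i \<omega>))" for n i
    using bound by (intro integrable_const_bound[of _ B] AE_I2) auto
  have "expectation (\<lambda>\<omega>. h n (X i \<omega>)) = \<mu> n" for n i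
    using integral_distr[OF X_meas h, of i n] integral_distr[OF X_meas h, of 0 n] distr_X[of i]
    by (simp add: \<mu>_def)
  then have E_S: "expectation (S n) = n * \<mu> n" for n
    using int_h by (simp add: S_def[abs_def])
  have S_bound: "\<bar>S n \<omega>\<bar> \<le> n * B" for n \<omega>
  proof -
    have "\<bar>S n \<omega>\<bar> \<le> (\<Sum>i=1..n. \<bar>h n (X i \<omega>)\<bar>)"
      unfolding S_def by (rule sum_abs)
    also have "\<dots> \<le> n * B"
      using sum_bounded_above[of "{1..n}" "\<lambda>i. \<bar>h n (X i \<omega>)\<bar>" B] bound by simp
    finally show ?thesis .
  qed
  have int_S2: "integrable M (\<lambda>\<omega>. (S n \<omega>)\<^sup>2)" for n
    using S_bound by (intro integrable_const_bound[of _ "(n * B)\<^sup>2"] AE_I2)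
      (auto simp: abs_le_square_iff[symmetric] intro: order_trans[OF _ abs_ge_self])
  have var_S: "variance (S n) \<le> n * (B * \<mu> n)" for n
    using second_moment_iid_sum[where h = "h n" and I = "{1..n}", OF X distr_X h bound] unfolding E_S
    by (simp add: S_def \<mu>_def)
  have k': "filterlim (\<lambda>n. real (k n)) at_top sequentially"
    by (rule filterlim_compose[OF filterlim_real_sequentially k])
  have "(\<lambda>n. 4 * B / e\<^sup>2 * (real n / real (k n) * \<mu> n) * inverse (real (k n))) \<longlonglongrightarrow> 4 * B / e\<^sup>2 * L * 0"
    using lim unfolding \<mu>_def
    by (intro tendsto_mult tendsto_const tendsto_inverse_0_at_top k')
  then have bound_0:
    "(\<lambda>n. 4 * B / e\<^sup>2 * (real n / real (k n) * \<mu> n) * inverse (real (k n))) \<longlonglongrightarrow> 0"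
    by simp
  have near: "\<forall>\<^sub>F n in sequentially. \<bar>real n / real (k n) * \<mu> n - L\<bar> < e / 2"
    using tendstoD[OF lim, of "e / 2"] e by (simp add: \<mu>_def dist_real_def)
  have k_pos: "\<forall>\<^sub>F n in sequentially. k n > 0"
    by (rule eventually_compose_filterlim[OF eventually_gt_at_top k])
  show "(\<lambda>n. measure M {\<omega> \<in> space M. e < \<bar>(\<Sum>i=1..n. h n (X i \<omega>)) / real (k n) - L\<bar>}) \<longlonglongrightarrow> 0"
  proof (rule Lim_null_comparison[OF _ bound_0])
    show "\<forall>\<^sub>F n in sequentially. norm (measure M {\<omega> \<in> space M. e < \<bar>(\<Sum>i=1..n. h n (X i \<omega>)) / real (k n) - L\<bar>})
        \<le> 4 * B / e\<^sup>2 * (real n / real (k n) * \<mu> n) * inverse (real (k n))"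
      using near k_pos
    proof eventually_elim
      case (elim n)
      \<comment> \<open>Half of \<open>e\<close> absorbs the distance of the mean from
        \<open>L\<close>; the other half, rescaled by \<open>k n\<close>, is the Chebyshev radius.
        Its square produces the factor \<open>4 / e\<^sup>2\<close>.\<close>
      let ?a = "e / 2 * real (k n)"
      have a: "?a > 0"
        using e elim by simp
      have "{\<omega> \<in> space M. e < \<bar>S n \<omega> / real (k n) - L\<bar>} \<subseteq>
          {\<omega> \<in> space M. \<bar>S n \<omega> - expectation (S n)\<bar> \<ge> ?a}"
      proof clarify
        fix \<omega> assume "e < \<bar>S n \<omega> / real (k n) - L\<bar>"
        then have "e / 2 \<le> \<bar>S n \<omega> / real (k n) - p\<bar>" if "\<bar>p - L\<bar> < e / 2" for p
          using that by linarith
        from this[OF elim(1)]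
        have "e / 2 \<le> \<bar>S n \<omega> / real (k n) - real n / real (k n) * \<mu> n\<bar>" .
        also have "\<dots> = \<bar>S n \<omega> - expectation (S n)\<bar> / real (k n)"
          using elim by (simp add: E_S diff_divide_distrib[symmetric] abs_divide)
        finally show "?a \<le> \<bar>S n \<omega> - expectation (S n)\<bar>"
          using elim by (simp add: pos_le_divide_eq)
      qed
      then have "measure M {\<omega> \<in> space M. e < \<bar>S n \<omega> / real (k n) - L\<bar>} \<le>
          measure M {\<omega> \<in> space M. \<bar>S n \<omega> - expectation (S n)\<bar> \<ge> ?a}"
        by (intro finite_measure_mono) auto
      also have "\<dots> \<le> variance (S n) / ?a\<^sup>2"
        using a by (intro Chebyshev_inequality int_S2) auto
      also have "\<dots> \<le> n * (B * \<mu> n) / ?a\<^sup>2"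
        using var_S by (intro divide_right_mono) auto
      also have "\<dots> = 4 * B / e\<^sup>2 * (real n / real (k n) * \<mu> n) * inverse (real (k n))"
        using elim e by (simp add: field_simps power2_eq_square)
      finally show ?case
        by (simp add: S_def)
    qed
  qed
qed

section \<open>Empirical measures with estimated normalization\<close>

lemma borel_measurable_fst_snd:
  fixes x :: "'a \<Rightarrow> 'b::topological_space \<times> 'c::topological_space"
  assumes "x \<in> borel_measurable M"
  shows "(\<lambda>\<omega>. fst (x \<omega>)) \<in> borel_measurable M" "(\<lambda>\<omega>. snd (x \<omega>)) \<in> borel_measurable M"
  by (rule borel_measurable_continuous_on[OF _ assms]; intro continuous_intros)+

lemma measurable_minima_sample:
  assumes "\<And>i. X i \<in> borel_measurable M"
  shows "minima_sample X n \<in> measurable M (Pi\<^sub>M {1..n} (\<lambda>_. borel))"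
  using borel_measurable_fst_snd[OF assms, measurable] unfolding minima_sample_def[abs_def] by measurable

lemma measurable_normalize_vec:
  assumes [measurable]: "a \<in> borel_measurable M" "b \<in> borel_measurable M"
    and x: "x \<in> borel_measurable M"
  shows "(\<lambda>\<omega>. normalize_vec (a \<omega>) (b \<omega>) (x \<omega>)) \<in> borel_measurable M"
  using borel_measurable_fst_snd[OF x, measurable] unfolding normalize_vec_def by measurable

text \<open>If \<open>a' = 0\<close>, then both sides are the origin because \<open>x / 0 = 0\<close>.\<close>

lemma normalize_vec_change:
  assumes "a \<noteq> 0" "normalize_vec a b x = (ereal y, ereal z)"
  shows "normalize_vec a' b' x =
    (ereal (a / a' * (y + (b - b') / a)), ereal (a / a' * (z + (b - b') / a)))"
proof -
  have "a / a' * ((t - b) / a + (b - b') / a) = (t - b') / a'" for t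
    using assms(1) by (simp add: add_divide_distrib[symmetric])
  moreover have "y = (fst x - b) / a" "z = (snd x - b) / a"
    using assms(2) by (auto simp: normalize_vec_def)
  ultimately show ?thesis
    by (simp only: normalize_vec_def)
qed

text \<open>The tail condition is used along the indices \<open>m n\<close>, the integer parts of
  \<open>n / k\<close>. It supplies the factor \<open>m n\<close> where the mean of the sum requires
  \<open>n / k\<close>, and the ratio of the two tends to 1.\<close>

lemma (in prob_space) weak_law_vague:
  fixes X :: "nat \<Rightarrow> 'a \<Rightarrow> real \<times> real" and E :: "(ereal \<times> ereal) set"
  assumes X: "indep_vars (\<lambda>_. borel) X UNIV"
    and distr_X: "\<And>i. distr M borel (X i) = distr M borel (X 0)"
    and E: "open E" and g: "g \<in> Ck_plus E"
    and tail: "limitin (vague_topology E)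
      (\<lambda>n. scale_measure (of_nat n)
        (restrict_space (distr M borel (\<lambda>\<omega>. normalize_vec (c n) (d n) (X 0 \<omega>))) E)) \<nu> sequentially"
    and k: "filterlim k at_top sequentially"
      "filterlim (\<lambda>n. real n / real (k n)) at_top sequentially"
  shows "converges_in_prob M (\<lambda>n \<omega>. (\<Sum>i=1..n. zero_extension E g
    (normalize_vec (at_ratio c n (k n)) (at_ratio d n (k n)) (X i \<omega>))) / real (k n)) (\<integral>x. g x \<partial>\<nu>)"
proof -
  have X_meas [measurable]: "X i \<in> borel_measurable M" for i
    using X by (auto simp: indep_vars_def)
  have [measurable]: "zero_extension E g \<in> borel_measurable borel"
    by (intro borel_measurable_continuous_onI continuous_on_zero_extension E g)
  have norm_meas [measurable]: "normalize_vec a b \<in> borel_measurable borel" for a b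
    using measurable_normalize_vec[of "\<lambda>_. a" borel "\<lambda>_. b" "\<lambda>x. x"] by simp
  obtain B where B: "\<And>x. zero_extension E g x \<le> B"
    using zero_extension_bounded[OF g] by blast
  define m where "m n = nat \<lfloor>real n / real (k n)\<rfloor>" for n
  let ?\<mu> = "\<lambda>j. expectation (\<lambda>\<omega>. zero_extension E g (normalize_vec (c j) (d j) (X 0 \<omega>)))"
  have floor_at_top: "filterlim (\<lambda>t::real. nat \<lfloor>t\<rfloor>) at_top at_top"
    by (rule filterlim_compose[OF filterlim_nat_sequentially filterlim_floor_sequentially])
  have m: "filterlim m at_top sequentially"
    unfolding m_def by (rule filterlim_compose[OF floor_at_top k(2)])
  have "((\<lambda>t::real. t / real_of_int \<lfloor>t\<rfloor>) \<longlongrightarrow> 1) at_top"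
    by real_asymp
  then have "(\<lambda>n. (real n / real (k n)) / real_of_int \<lfloor>real n / real (k n)\<rfloor>) \<longlonglongrightarrow> 1"
    by (rule filterlim_compose[OF _ k(2)])
  then have ratio: "(\<lambda>n. (real n / real (k n)) / real (m n)) \<longlonglongrightarrow> 1"
    by (simp add: m_def)
  have "(\<integral>x. g x \<partial>scale_measure (of_nat j)
      (restrict_space (distr M borel (\<lambda>\<omega>. normalize_vec (c j) (d j) (X 0 \<omega>))) E)) = real j * ?\<mu> j" for j
    unfolding ennreal_of_nat_eq_real_of_nat
    by (rule integral_scale_restrict_distr[OF _ _ _ g]) (use E in simp_all)
  with limitin_vague_topology_integral[OF tail g] have "(\<lambda>j. real j * ?\<mu> j) \<longlonglongrightarrow> (\<integral>x. g x \<partial>\<nu>)"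
    by simp
  from filterlim_compose[OF this m]
  have "(\<lambda>n. (real n / real (k n)) / real (m n) * (real (m n) * ?\<mu> (m n))) \<longlonglongrightarrow> 1 * (\<integral>x. g x \<partial>\<nu>)"
    by (rule tendsto_mult[OF ratio])
  \<comment> \<open>Cancelling \<open>m n\<close> is legitimate only where it is nonzero, which
    holds eventually.\<close>
  moreover have "\<forall>\<^sub>F n in sequentially. m n > 0"
    by (rule eventually_compose_filterlim[OF eventually_gt_at_top m])
  then have "\<forall>\<^sub>F n in sequentially. (real n / real (k n)) / real (m n) * (real (m n) * ?\<mu> (m n)) =
      real n / real (k n) * ?\<mu> (m n)"
    by eventually_elim simp
  ultimately have lim: "(\<lambda>n. real n / real (k n) * ?\<mu> (m n)) \<longlonglongrightarrow> (\<integral>x. g x \<partial>\<nu>)"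
    using tendsto_cong by fastforce
  show ?thesis
    by (rule weak_law_rare_events[OF X distr_X _ zero_extension_nonneg[OF g] B k(1)])
      (use lim in \<open>simp_all add: at_ratio_def m_def\<close>)
qed

theorem proposition2p8:
  fixes M :: "'w measure"
    and X :: "nat \<Rightarrow> 'w \<Rightarrow> real \<times> real"
    and E0 :: "(ereal \<times> ereal) set"
    and \<nu>0 :: "(ereal \<times> ereal) measure"
    and c d :: "nat \<Rightarrow> real"
    and k :: "nat \<Rightarrow> nat"
    and c_est d_est :: "nat \<Rightarrow> (nat \<Rightarrow> real) \<Rightarrow> real"
  assumes "prob_space M"
    and iid: "prob_space.indep_vars M (\<lambda>_. borel) X UNIV"
             "\<And>i. distr M borel (X i) = distr M borel (X 0)"
    and cone: "E0 = {-\<infinity><..} \<times> {-\<infinity><..} \<or> E0 = {0<..} \<times> {0<..}"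
    and c_pos: "\<And>n. n \<ge> 1 \<Longrightarrow> c n > 0"
    and \<nu>0: "\<nu>0 \<in> radon_measures E0" "emeasure \<nu>0 E0 \<noteq> 0"
    and tail: "limitin (vague_topology E0)
          (\<lambda>n. scale_measure (of_nat n)
             (restrict_space (distr M borel (\<lambda>\<omega>. normalize_vec (c n) (d n) (X 0 \<omega>))) E0))
          \<nu>0 sequentially"
    and k: "filterlim k at_top sequentially"
           "filterlim (\<lambda>n. real n / real (k n)) at_top sequentially"
    and est_measurable:
          "\<And>n. c_est n \<in> borel_measurable (Pi\<^sub>M {1..n} (\<lambda>_. borel))"
          "\<And>n. d_est n \<in> borel_measurable (Pi\<^sub>M {1..n} (\<lambda>_. borel))"
    and c_est: "converges_in_prob M
          (\<lambda>n \<omega>. at_ratio c n (k n) / c_est n (minima_sample X n \<omega>)) 1"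
    and d_est: "converges_in_prob M
          (\<lambda>n \<omega>. (at_ratio d n (k n) - d_est n (minima_sample X n \<omega>)) / at_ratio c n (k n)) 0"
  shows "converges_weakly M (vague_topology E0)
          (\<lambda>n \<omega>. empirical_measure E0 (k n) n
             (\<lambda>i. normalize_vec (c_est n (minima_sample X n \<omega>)) (d_est n (minima_sample X n \<omega>)) (X i \<omega>)))
          (\<lambda>_. \<nu>0)"
proof -
  interpret prob_space M by fact
  \<comment> \<open>Both cones are squares of an open ray, with \<open>l\<close> equal to
    \<open>-\<infinity>\<close> or 0, and are treated together.\<close>
  obtain l :: ereal where l: "l < \<infinity>" "E0 = {l<..} \<times> {l<..}"
    using cone that[of "-\<infinity>"] that[of 0] by auto
  have "open E0"
    by (simp add: l(2) open_Times)
  have X_meas [measurable]: "X i \<in> borel_measurable M" for i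
    using iid(1) by (auto simp: indep_vars_def)
  define A where "A n \<omega> = c_est n (minima_sample X n \<omega>)" for n \<omega>
  define B where "B n \<omega> = d_est n (minima_sample X n \<omega>)" for n \<omega>
  define C where "C n = at_ratio c n (k n)" for n
  define D where "D n = at_ratio d n (k n)" for n
  have [measurable]: "A n \<in> borel_measurable M" "B n \<in> borel_measurable M" for n
    unfolding A_def[abs_def] B_def[abs_def]
    using measurable_minima_sample[of X M n, OF X_meas] est_measurable[of n]
    by (auto intro: measurable_compose)
  have norm_meas: "(\<lambda>\<omega>. normalize_vec (A n \<omega>) (B n \<omega>) (X i \<omega>)) \<in> borel_measurable M"
    "(\<lambda>\<omega>. normalize_vec (C n) (D n) (X i \<omega>)) \<in> borel_measurable M" for n i
    by (auto intro: measurable_normalize_vec)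
  let ?Y = "\<lambda>n \<omega>. empirical_measure E0 (k n) n (\<lambda>i. normalize_vec (A n \<omega>) (B n \<omega>) (X i \<omega>))"
  \<comment> \<open>Positivity of \<open>c\<close> is given from index 1 on, and the integer part of
    \<open>n / k\<close> reaches 1 only for large \<open>n\<close>.\<close>
  have C_pos: "\<forall>\<^sub>F n in sequentially. C n > 0"
  proof -
    have "\<forall>\<^sub>F n in sequentially. 1 \<le> real n / real (k n)"
      using k(2) by (simp add: filterlim_at_top)
    then show ?thesis
      by eventually_elim (simp add: C_def at_ratio_def c_pos le_nat_floor)
  qed
  have "converges_weakly M (vague_topology E0) ?Y (\<lambda>_. \<nu>0)"
  proof (rule converges_weakly_vague_constI[OF assms(1) _ \<nu>0(1)])
    show "?Y n \<in> measurable M (borel_sets_of (vague_topology E0))" for n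
      by (rule measurable_empirical_measure[OF \<open>open E0\<close> norm_meas(1)])
    fix f assume f: "f \<in> Ck_plus E0"
    let ?ext = "zero_extension E0"
    obtain g where g: "g \<in> Ck_plus E0" and perturb:
      "\<And>e. e > 0 \<Longrightarrow> \<exists>\<delta>>0. \<forall>a b x y. \<bar>a - 1\<bar> \<le> \<delta> \<longrightarrow> \<bar>b\<bar> \<le> \<delta> \<longrightarrow>
        \<bar>?ext f (ereal (a * (x + b)), ereal (a * (y + b))) - ?ext f (ereal x, ereal y)\<bar>
          \<le> e * ?ext g (ereal x, ereal y)"
      using zero_extension_quadrant_perturbation[OF l(1), of f] f unfolding l(2) by blast
    \<comment> \<open>This is the integral of \<open>h\<close> against the empirical measure
      normalized by the true constants.\<close>
    define S where "S h n \<omega> = (\<Sum>i=1..n. ?ext h (normalize_vec (C n) (D n) (X i \<omega>))) / real (k n)"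
      for h n \<omega>
    have law: "converges_in_prob M (S h) (\<integral>x. h x \<partial>\<nu>0)" if "h \<in> Ck_plus E0" for h
      unfolding S_def[abs_def] C_def D_def
      by (rule weak_law_vague[OF iid \<open>open E0\<close> that tail k])
    have S_meas [measurable]: "S h n \<in> borel_measurable M" if "h \<in> Ck_plus E0" for h n
    proof -
      have [measurable]: "?ext h \<in> borel_measurable borel"
        by (intro borel_measurable_continuous_onI continuous_on_zero_extension \<open>open E0\<close> that)
      show ?thesis
        unfolding S_def[abs_def] using norm_meas(2)[measurable] by measurable
    qed
    show "converges_in_prob M (\<lambda>n \<omega>. \<integral>x. f x \<partial>?Y n \<omega>) (\<integral>x. f x \<partial>\<nu>0)"
      unfolding converges_in_prob_def
    proof (intro allI impI)
      fix e :: real assume "e > 0"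
      have "0 \<le> (\<integral>x. g x \<partial>\<nu>0)"
      proof (rule integral_nonneg_AE, rule AE_I2)
        fix x assume "x \<in> space \<nu>0"
        moreover have "space \<nu>0 = E0"
          using sets_eq_imp_space_eq[of \<nu>0 "restrict_space borel E0"] \<nu>0(1)
          by (simp add: radon_measures_def space_restrict_space)
        ultimately show "0 \<le> g x"
          using g by (simp add: Ck_plus_def)
      qed
      \<comment> \<open>Once \<open>S g n\<close> is within 1 of its limit, it is at most
        \<open>r\<close>; the perturbation error \<open>e / (2 * r)\<close> times
        \<open>S g n\<close> is then at most \<open>e / 2\<close>.\<close>
      define r where "r = (\<integral>x. g x \<partial>\<nu>0) + 1"
      have "r > 0"
        using \<open>0 \<le> (\<integral>x. g x \<partial>\<nu>0)\<close> by (simp add: r_def)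
      then have "e / (2 * r) > 0"
        using \<open>e > 0\<close> by simp
      from perturb[OF this] obtain \<delta> where "\<delta> > 0" and \<delta>:
        "\<And>a b x y. \<bar>a - 1\<bar> \<le> \<delta> \<Longrightarrow> \<bar>b\<bar> \<le> \<delta> \<Longrightarrow>
          \<bar>?ext f (ereal (a * (x + b)), ereal (a * (y + b))) - ?ext f (ereal x, ereal y)\<bar>
            \<le> e / (2 * r) * ?ext g (ereal x, ereal y)"
        by blast
      \<comment> \<open>The first two events are failures of the estimators, the third allows
        \<open>S g n\<close> to be large, and the fourth is the deviation under the true constants.
        Outside all four the total error is at most \<open>e\<close>.\<close>
      let ?E1 = "\<lambda>n. {\<omega> \<in> space M. \<delta> < \<bar>C n / A n \<omega> - 1\<bar>}"
      let ?E2 = "\<lambda>n. {\<omega> \<in> space M. \<delta> < \<bar>(D n - B n \<omega>) / C n - 0\<bar>}"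
      let ?E3 = "\<lambda>n. {\<omega> \<in> space M. 1 < \<bar>S g n \<omega> - (\<integral>x. g x \<partial>\<nu>0)\<bar>}"
      let ?E4 = "\<lambda>n. {\<omega> \<in> space M. e / 2 < \<bar>S f n \<omega> - (\<integral>x. f x \<partial>\<nu>0)\<bar>}"
      let ?bad = "\<lambda>n. {\<omega> \<in> space M. e < \<bar>(\<integral>x. f x \<partial>?Y n \<omega>) - (\<integral>x. f x \<partial>\<nu>0)\<bar>}"
      note [measurable] = S_meas[OF f] S_meas[OF g]
      have meas: "?E1 n \<in> sets M" "?E2 n \<in> sets M" "?E3 n \<in> sets M" "?E4 n \<in> sets M" for n
        by measurable
      have lim1: "(\<lambda>n. measure M (?E1 n)) \<longlonglongrightarrow> 0"
        using c_est \<open>\<delta> > 0\<close> unfolding converges_in_prob_def A_def C_def by blast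
      have lim2: "(\<lambda>n. measure M (?E2 n)) \<longlonglongrightarrow> 0"
        using d_est \<open>\<delta> > 0\<close> unfolding converges_in_prob_def B_def C_def D_def by blast
      have lim3: "(\<lambda>n. measure M (?E3 n)) \<longlonglongrightarrow> 0"
        by (rule law[OF g, unfolded converges_in_prob_def, rule_format]) simp
      have lim4: "(\<lambda>n. measure M (?E4 n)) \<longlonglongrightarrow> 0"
        using \<open>e > 0\<close> by (intro law[OF f, unfolded converges_in_prob_def, rule_format]) simp
      have lim: "(\<lambda>n. measure M (?E1 n) + measure M (?E2 n) + measure M (?E3 n) + measure M (?E4 n))
          \<longlonglongrightarrow> 0"
        using tendsto_add[OF tendsto_add[OF tendsto_add[OF lim1 lim2] lim3] lim4] by simp
      show "(\<lambda>n. measure M (?bad n)) \<longlonglongrightarrow> 0"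
      proof (rule Lim_null_comparison[OF _ lim])
        show "\<forall>\<^sub>F n in sequentially. norm (measure M (?bad n)) \<le>
            measure M (?E1 n) + measure M (?E2 n) + measure M (?E3 n) + measure M (?E4 n)"
          using C_pos
        proof eventually_elim
          case (elim n)
          have "?bad n \<subseteq> ?E1 n \<union> ?E2 n \<union> ?E3 n \<union> ?E4 n"
          proof (rule subsetI, rule ccontr)
            fix \<omega> assume "\<omega> \<in> ?bad n" "\<omega> \<notin> ?E1 n \<union> ?E2 n \<union> ?E3 n \<union> ?E4 n"
            then have bad: "e < \<bar>(\<integral>x. f x \<partial>?Y n \<omega>) - (\<integral>x. f x \<partial>\<nu>0)\<bar>"
              and close: "\<bar>C n / A n \<omega> - 1\<bar> \<le> \<delta>" "\<bar>(D n - B n \<omega>) / C n\<bar> \<le> \<delta>"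
                "\<bar>S g n \<omega> - (\<integral>x. g x \<partial>\<nu>0)\<bar> \<le> 1" "\<bar>S f n \<omega> - (\<integral>x. f x \<partial>\<nu>0)\<bar> \<le> e / 2"
              by (simp_all add: not_less)
            let ?u = "\<lambda>i. normalize_vec (A n \<omega>) (B n \<omega>) (X i \<omega>)"
            let ?v = "\<lambda>i. normalize_vec (C n) (D n) (X i \<omega>)"
            have termwise: "\<bar>?ext f (?u i) - ?ext f (?v i)\<bar> \<le> e / (2 * r) * ?ext g (?v i)" for i
            proof -
              obtain y z where v: "?v i = (ereal y, ereal z)"
                by (simp add: normalize_vec_def)
              have "C n \<noteq> 0"
                using elim by simp
              show ?thesis
                \<comment> \<open>The change of normalization has scale
                  \<open>C n / A n \<omega>\<close> and shift
                  \<open>(D n - B n \<omega>) / C n\<close>, the quantities controlled by the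
                  estimator hypotheses. A vanishing \<open>A n \<omega>\<close> is covered by the
                  same identity.\<close>
                unfolding v normalize_vec_change[OF \<open>C n \<noteq> 0\<close> v, of "A n \<omega>" "B n \<omega>"]
                by (rule \<delta>[OF close(1,2)])
            qed
            have "(\<integral>x. f x \<partial>?Y n \<omega>) = (\<Sum>i=1..n. ?ext f (?u i)) / real (k n)"
              by (rule integral_empirical_measure[OF borel_open[OF \<open>open E0\<close>] f])
            then have "\<bar>(\<integral>x. f x \<partial>?Y n \<omega>) - S f n \<omega>\<bar> =
                \<bar>\<Sum>i=1..n. ?ext f (?u i) - ?ext f (?v i)\<bar> / real (k n)"
              by (simp add: S_def sum_subtractf diff_divide_distrib[symmetric])
            also have "\<dots> \<le> (\<Sum>i=1..n. e / (2 * r) * ?ext g (?v i)) / real (k n)"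
              by (intro divide_right_mono sum_abs[THEN order_trans] sum_mono termwise) simp
            also have "\<dots> = e / (2 * r) * S g n \<omega>"
              by (simp add: S_def sum_distrib_left)
            also have "\<dots> \<le> e / (2 * r) * r"
              using close(3) \<open>e / (2 * r) > 0\<close> by (intro mult_left_mono) (auto simp: r_def)
            also have "\<dots> = e / 2"
              using \<open>r > 0\<close> by simp
            finally show False
              using bad close(4) by linarith
          qed
          then have "measure M (?bad n) \<le> measure M (?E1 n \<union> ?E2 n \<union> ?E3 n \<union> ?E4 n)"
            using meas by (intro finite_measure_mono) auto
          also have "\<dots> \<le> measure M (?E1 n) + measure M (?E2 n) + measure M (?E3 n) + measure M (?E4 n)"
            using meas[of n] by (intro order_trans[OF measure_Un_le] add_right_mono sets.Un) auto
          finally show ?case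
            by simp
        qed
      qed
    qed
  qed
  then show ?thesis
    unfolding A_def B_def .
qed

end
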